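(* Let $G$ be a connected $\{P_6,\text{dart},K_4\}$-free graph with no clique cutset, and let $H$ be an induced diamond in $G$ with $V(H)=\{u_1,u_2,u_3,u_4\}$ and $E(H)=\{u_1u_2,u_2u_3,u_3u_4,u_4u_1,u_1u_3\}$. Let $A_2,B_{13},C_2,C_4$ and the auxiliary graph $S$ on vertex set $A_2$ be as defined in the context, and assume $C_2=C_4=\emptyset$ and $B_{13}\neq\emptyset$. Let $x,y\in A_2$. If $xy\in E(G)$, then $x$ and $y$ lie in distinct components of $S$.
   Context: All graphs are finite, simple and undirected. $P_6$ is the path on $6$ vertices. A diamond is $K_4$ minus an edge; a dart is the graph obtained from a diamond by adding a new vertex adjacent to exactly one vertex of the diamond, that vertex being one of degree $3$ in the diamond. $\{P_6,\text{dart},K_4\}$-free means having no induced subgraph isomorphic to $P_6$, the dart, or $K_4$. A clique cutset of $G$ is a clique $K\subseteq V(G)$ such that $G\setminus K$ has more components than $G$. $G[X]$ is the subgraph induced by $X$; components of $G[X]$ are identified with their vertex sets. For $x\in V(G)\setminus V(H)$ write $N_H(x)=N(x)\cap V(H)$. Define $A_2=\{x\in V(G)\setminus V(H):N_H(x)=\{u_2\}\}$, $B_{13}=\{x\in V(G)\setminus V(H):N_H(x)=\{u_1,u_3\}\}$, $C_2=\{x\in V(G)\setminus V(H):N_H(x)=\{u_2,u_3,u_4\}\}$, $C_4=\{x\in V(G)\setminus V(H):N_H(x)=\{u_4,u_1,u_2\}\}$, $Z=\{x\in V(G)\setminus V(H):N_H(x)=\emptyset\}$. $Z_1$ is the union of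 those components of $G[Z]$ that have a neighbor in $A_2$ (i.e. contain a vertex adjacent to some vertex of $A_2$). A component $Q=\{q,q'\}$ of $G[Z_1]$ (with exactly two vertices) is called bad if $qq'\in E(G)$ and both $q$ and $q'$ have a neighbor in $B_{13}$. For a component $Q$ of $G[Z_1]$, $N_{A_2}(Q)$ is the set of vertices of $A_2$ having a neighbor in $Q$. The auxiliary graph $S$ has vertex set $A_2$; for distinct $x,y\in A_2$, $xy\in E(S)$ if and only if there exists a bad component $Q$ of $G[Z_1]$ such that $x,y\in N_{A_2}(Q)$. *)

theory Defs
  imports Graph_Theory.Graph_Theory
begin

text \<open>
  Finite simple undirected graphs are the models of locale \<^locale>\<open>graph\<close>, i.e. finite
  symmetric digraphs without loops and parallel arcs; an edge \<open>uv\<close> is the pair of arcs from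
  \<open>u\<close> to \<open>v\<close> and back. In such a graph the strongly connected components are the usual
  connected components; they are represented by their vertex sets.
\<close>

abbreviation components :: "('a,'b) pre_digraph \<Rightarrow> 'a set set" where
  "components G \<equiv> pre_digraph.sccs_verts G"

definition undirected :: "'a rel \<Rightarrow> 'a rel" where
  "undirected E = E \<union> E\<inverse>"

definition diamond_edges :: "'a \<Rightarrow> 'a \<Rightarrow> 'a \<Rightarrow> 'a \<Rightarrow> 'a rel" where
  "diamond_edges u1 u2 u3 u4 = undirected {(u1,u2), (u2,u3), (u3,u4), (u4,u1), (u1,u3)}"

definition path_graph :: "nat \<Rightarrow> nat pair_pre_digraph" where
  "path_graph n = \<lparr> pverts = {..<n}, parcs = undirected {(i, Suc i) | i. Suc i < n} \<rparr>"

text \<open>The vertices 0 and 2 have degree 3 in the diamond on 0, 1, 2, 3.\<close>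

definition dart_graph :: "nat pair_pre_digraph" where
  "dart_graph = \<lparr> pverts = {0,1,2,3,4}, parcs = diamond_edges 0 1 2 3 \<union> undirected {(0,4)} \<rparr>"

definition P6_dart_K4_free :: "('a,'b) pre_digraph \<Rightarrow> bool" where
  "P6_dart_K4_free G \<longleftrightarrow>
     \<not> (\<exists>F. induced_subgraph F G \<and>
          (digraph_iso (with_proj (path_graph 6)) F
           \<or> digraph_iso (with_proj dart_graph) F
           \<or> K\<^bsub>4\<^esub> F))"

definition clique :: "('a,'b) pre_digraph \<Rightarrow> 'a set \<Rightarrow> bool" where
  "clique G K \<longleftrightarrow> K \<subseteq> verts G \<and> (\<forall>x\<in>K. \<forall>y\<in>K. x \<noteq> y \<longrightarrow> x \<rightarrow>\<^bsub>G\<^esub> y)"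

definition clique_cutset :: "('a,'b) pre_digraph \<Rightarrow> 'a set \<Rightarrow> bool" where
  "clique_cutset G K \<longleftrightarrow>
     clique G K \<and> card (components (G \<restriction> (verts G - K))) > card (components G)"

definition nbrs_in :: "('a,'b) pre_digraph \<Rightarrow> 'a set \<Rightarrow> 'a \<Rightarrow> 'a set" where
  "nbrs_in G X x = {v \<in> X. x \<rightarrow>\<^bsub>G\<^esub> v}"

text \<open>
  The sets \<open>A\<^sub>2\<close>, \<open>B\<^sub>1\<^sub>3\<close>, \<open>C\<^sub>2\<close>, \<open>C\<^sub>4\<close> and \<open>Z\<close> are \<open>attached G H T\<close> for \<open>T\<close> equal to
  \<open>{u\<^sub>2}\<close>, \<open>{u\<^sub>1, u\<^sub>3}\<close>, \<open>{u\<^sub>2, u\<^sub>3, u\<^sub>4}\<close>, \<open>{u\<^sub>4, u\<^sub>1, u\<^sub>2}\<close> and \<open>{}\<close>.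
\<close>

definition attached :: "('a,'b) pre_digraph \<Rightarrow> ('a,'b) pre_digraph \<Rightarrow> 'a set \<Rightarrow> 'a set" where
  "attached G H T = {x \<in> verts G - verts H. nbrs_in G (verts H) x = T}"

definition Z1 :: "('a,'b) pre_digraph \<Rightarrow> ('a,'b) pre_digraph \<Rightarrow> 'a \<Rightarrow> 'a set" where
  "Z1 G H u2 = \<Union> {Q \<in> components (G \<restriction> attached G H {}).
                     \<exists>q\<in>Q. \<exists>a\<in>attached G H {u2}. q \<rightarrow>\<^bsub>G\<^esub> a}"

definition bad_component ::
  "('a,'b) pre_digraph \<Rightarrow> ('a,'b) pre_digraph \<Rightarrow> 'a \<Rightarrow> 'a \<Rightarrow> 'a \<Rightarrow> 'a set \<Rightarrow> bool" where
  "bad_component G H u1 u2 u3 Q \<longleftrightarrow>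
     Q \<in> components (G \<restriction> Z1 G H u2) \<and>
     (\<exists>q q'. q \<noteq> q' \<and> Q = {q, q'} \<and> q \<rightarrow>\<^bsub>G\<^esub> q' \<and>
        (\<exists>b\<in>attached G H {u1, u3}. q \<rightarrow>\<^bsub>G\<^esub> b) \<and>
        (\<exists>b\<in>attached G H {u1, u3}. q' \<rightarrow>\<^bsub>G\<^esub> b))"

definition A2_nbrs :: "('a,'b) pre_digraph \<Rightarrow> ('a,'b) pre_digraph \<Rightarrow> 'a \<Rightarrow> 'a set \<Rightarrow> 'a set" where
  "A2_nbrs G H u2 Q = {a \<in> attached G H {u2}. \<exists>q\<in>Q. a \<rightarrow>\<^bsub>G\<^esub> q}"

definition aux_graph ::
  "('a,'b) pre_digraph \<Rightarrow> ('a,'b) pre_digraph \<Rightarrow> 'a \<Rightarrow> 'a \<Rightarrow> 'a \<Rightarrow> 'a pair_pre_digraph" where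
  "aux_graph G H u1 u2 u3 =
     \<lparr> pverts = attached G H {u2},
       parcs = {(x, y). x \<in> attached G H {u2} \<and> y \<in> attached G H {u2} \<and> x \<noteq> y \<and>
                  (\<exists>Q. bad_component G H u1 u2 u3 Q \<and>
                       x \<in> A2_nbrs G H u2 Q \<and> y \<in> A2_nbrs G H u2 Q)} \<rparr>"

end

theory Submission
  imports Defs
begin

text \<open>
  The auxiliary graph \<open>S\<close> has an invariant: every \<open>b \<in> B\<^sub>1\<^sub>3\<close> is either complete or anticomplete to
  each component of \<open>S\<close>. Suppose that adjacent \<open>x, y \<in> A\<^sub>2\<close> lie in one component of \<open>S\<close>.
  Then \<open>x\<close> has a neighbour in \<open>S\<close>, so some bad component \<open>Q\<close> has two neighbours in \<open>A\<^sub>2\<close>, one of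
  which is \<open>x\<close>. Let \<open>b \<in> B\<^sub>1\<^sub>3\<close> be adjacent to \<open>q \<in> Q\<close>. It turns out that \<open>b\<close> misses \<open>x\<close>, hence
  by the invariant also \<open>y\<close>, while \<open>y\<close> misses \<open>q\<close>; so \<open>y - x - q - b - u\<^sub>1 - u\<^sub>4\<close> is an induced
  \<open>P\<^sub>6\<close>, a contradiction.

  The facts behind this, for an edge \<open>qq'\<close> of \<open>G[Z]\<close>, are as follows. A vertex \<open>a \<in> A\<^sub>2\<close> adjacent
  to \<open>q\<close> is adjacent to \<open>q'\<close>, as otherwise \<open>u\<^sub>4 - u\<^sub>1 - u\<^sub>2 - a - q - q'\<close> is an induced \<open>P\<^sub>6\<close>
  (lemma \<open>A2_complete_to_Z_edge\<close>); therefore \<open>N\<^bsub>A\<^sub>2\<^esub>(Q)\<close> is stable, since \<open>G\<close> has no \<open>K\<^sub>4\<close>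
  (lemma \<open>A2_nbrs_of_Z_edge_stable\<close>). If \<open>q\<close> has two neighbours in \<open>A\<^sub>2\<close>, then excluding darts
  and \<open>K\<^sub>4\<close> shows that a vertex of \<open>B\<^sub>1\<^sub>3\<close> adjacent to \<open>q\<close> misses both of them
  (lemma \<open>B13_nbr_of_Z_edge_anticomplete\<close>). Finally, if \<open>b \<in> B\<^sub>1\<^sub>3\<close> were adjacent to exactly one of
  two \<open>S\<close>-adjacent vertices \<open>x\<^sub>1, x\<^sub>2\<close>, say \<open>x\<^sub>1\<close>, then \<open>b\<close> misses their common neighbour \<open>q\<close>, and
  \<open>x\<^sub>2 - q - x\<^sub>1 - b - u\<^sub>1 - u\<^sub>4\<close> is an induced \<open>P\<^sub>6\<close> (lemma \<open>B13_adj_invariant_step\<close>).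
\<close>

section \<open>Embeddings as induced subgraphs\<close>

(* The arrow is reserved for adjacency. *)
unbundle no funcset_syntax

lemma adj_induce_subgraph_iff:
  "u \<rightarrow>\<^bsub>G \<restriction> S\<^esub> v \<longleftrightarrow> u \<rightarrow>\<^bsub>G\<^esub> v \<and> u \<in> S \<and> v \<in> S"
  by (auto simp: arcs_ends_conv)

text \<open>
  Without parallel arcs, an injection of vertices that preserves and reflects adjacency determines
  the map on arcs, and hence an isomorphism onto the subgraph induced by its image.
\<close>
lemma (in nomulti_digraph) digraph_iso_induce_image:
  fixes P :: "'c pair_pre_digraph"
  assumes wf: "wf_digraph (with_proj P)"
    and inj: "inj_on f (pverts P)"
    and adj: "\<And>u v. u \<in> pverts P \<Longrightarrow> v \<in> pverts P \<Longrightarrow> (u, v) \<in> parcs P \<longleftrightarrow> f u \<rightarrow> f v"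
  shows "digraph_iso (with_proj P) (G \<restriction> f ` pverts P)"
proof -
  interpret P: wf_digraph "with_proj P" by (rule wf)
  have ends: "u \<in> pverts P" "v \<in> pverts P" if "(u, v) \<in> parcs P" for u v
    using P.tail_in_verts[of "(u, v)"] P.head_in_verts[of "(u, v)"] that by auto
  define g where "g = (\<lambda>(u, v). the_inv_into (arcs G) (arc_to_ends G) (f u, f v))"
  have g: "g (u, v) \<in> arcs G" "tail G (g (u, v)) = f u" "head G (g (u, v)) = f v"
    if "(u, v) \<in> parcs P" for u v
  proof -
    have "(f u, f v) \<in> arc_to_ends G ` arcs G"
      using adj[OF ends[OF that]] that unfolding arcs_ends_def by blast
    then show "g (u, v) \<in> arcs G" "tail G (g (u, v)) = f u" "head G (g (u, v)) = f v"
      using f_the_inv_into_f[OF inj_on_arc_to_ends] the_inv_into_into[OF inj_on_arc_to_ends]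
      by (auto simp: g_def arc_to_ends_def)
  qed
  let ?h = "\<lparr>iso_verts = f, iso_arcs = g, iso_head = head G, iso_tail = tail G\<rparr>"
  have "inj_on g (parcs P)"
  proof (rule inj_onI, clarify)
    fix u v u' v' assume A: "(u, v) \<in> parcs P" "(u', v') \<in> parcs P" "g (u, v) = g (u', v')"
    then have "f u = f u'" "f v = f v'" using g by metis+
    then show "u = u' \<and> v = v'" using A ends inj by (meson inj_onD)
  qed
  then have "pre_digraph.digraph_isomorphism (with_proj P) ?h"
    using wf inj g by (auto simp: pre_digraph.digraph_isomorphism_def)
  moreover have "G \<restriction> f ` pverts P = app_iso ?h (with_proj P)"
  proof -
    have "{e \<in> arcs G. tail G e \<in> f ` pverts P \<and> head G e \<in> f ` pverts P} = g ` parcs P"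
    proof (intro set_eqI iffI)
      fix e assume "e \<in> {e \<in> arcs G. tail G e \<in> f ` pverts P \<and> head G e \<in> f ` pverts P}"
      then obtain u v where e: "e \<in> arcs G" "tail G e = f u" "head G e = f v"
        "u \<in> pverts P" "v \<in> pverts P" by auto
      have "f u \<rightarrow> f v" unfolding arcs_ends_conv using e by (intro image_eqI[of _ _ e]) simp_all
      then have uv: "(u, v) \<in> parcs P" using adj e by simp
      then have "e = g (u, v)"
        using g[OF uv] e by (intro no_multi_arcs) (auto simp: arc_to_ends_def)
      then show "e \<in> g ` parcs P" using uv by simp
    next
      fix e assume "e \<in> g ` parcs P"
      then obtain u v where uv: "(u, v) \<in> parcs P" "e = g (u, v)" by auto
      then show "e \<in> {e \<in> arcs G. tail G e \<in> f ` pverts P \<and> head G e \<in> f ` pverts P}"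
        using g[OF uv(1)] ends[OF uv(1)] by simp
    qed
    then show ?thesis by (simp add: induce_subgraph_def app_iso_def)
  qed
  ultimately show ?thesis unfolding digraph_iso_def by blast
qed

section \<open>The forbidden induced subgraphs, pointwise\<close>

locale P6_dart_K4_free_graph = graph G for G :: "('a, 'b) pre_digraph" (structure) +
  assumes free: "P6_dart_K4_free G"
begin

lemma adj_sym: "u \<rightarrow> v \<Longrightarrow> v \<rightarrow> u"
  using arcs_ends_symmetric[OF sym_arcs] .

lemma irrefl: "\<not> v \<rightarrow> v"
  using adj_not_same by blast

lemma adj_neq: "u \<rightarrow> v \<Longrightarrow> u \<noteq> v"
  using irrefl by blast

text \<open>No two vertices of \<open>P\<^sub>6\<close> have equal neighbourhoods, so distinctness need not be assumed.\<close>
lemma no_induced_P6: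
  assumes e: "a \<rightarrow> b" "b \<rightarrow> c" "c \<rightarrow> d" "d \<rightarrow> e" "e \<rightarrow> f"
    and n: "\<not> a \<rightarrow> c" "\<not> a \<rightarrow> d" "\<not> a \<rightarrow> e" "\<not> a \<rightarrow> f" "\<not> b \<rightarrow> d" "\<not> b \<rightarrow> e" "\<not> b \<rightarrow> f"
      "\<not> c \<rightarrow> e" "\<not> c \<rightarrow> f" "\<not> d \<rightarrow> f"
  shows False
proof -
  let ?l = "[a, b, c, d, e, f]"
  let ?P = "path_graph 6"
  have e': "b \<rightarrow> a" "c \<rightarrow> b" "d \<rightarrow> c" "e \<rightarrow> d" "f \<rightarrow> e" using e adj_sym by blast+
  have n': "\<not> c \<rightarrow> a" "\<not> d \<rightarrow> a" "\<not> e \<rightarrow> a" "\<not> f \<rightarrow> a" "\<not> d \<rightarrow> b" "\<not> e \<rightarrow> b" "\<not> f \<rightarrow> b"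
    "\<not> e \<rightarrow> c" "\<not> f \<rightarrow> c" "\<not> f \<rightarrow> d" using n adj_sym by blast+
  have dist: "distinct ?l"
    using e n adj_neq[of a b] adj_neq[of b c] adj_neq[of c d] adj_neq[of d e] adj_neq[of e f] n' e'
    unfolding distinct.simps list.set by blast
  have P: "pverts ?P = {0, 1, 2, 3, 4, 5}"
    "parcs ?P = undirected {(0, 1), (1, 2), (2, 3), (3, 4), (4, 5)}"
  proof -
    have "Suc i < 6 \<longleftrightarrow> i = 0 \<or> i = 1 \<or> i = 2 \<or> i = 3 \<or> i = 4" for i :: nat by auto
    then have "{(i, Suc i) |i. Suc i < 6} = (\<lambda>i. (i, Suc i)) ` {0, 1, 2, 3, 4}" by blast
    then have "{(i, Suc i) |i. Suc i < 6} = {(0, 1), (1, 2), (2, 3), (3, 4), (4, 5)}"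
      by (simp add: eval_nat_numeral)
    then show "parcs ?P = undirected {(0, 1), (1, 2), (2, 3), (3, 4), (4, 5)}"
      by (simp add: path_graph_def)
    show "pverts ?P = {0, 1, 2, 3, 4, 5}" by (auto simp: path_graph_def)
  qed
  have "digraph_iso (with_proj ?P) (G \<restriction> (!) ?l ` pverts ?P)"
  proof (rule digraph_iso_induce_image)
    show "wf_digraph (with_proj ?P)"
      by unfold_locales (auto simp: P undirected_def)
    show "inj_on ((!) ?l) (pverts ?P)"
      using dist by (intro inj_on_nth) (auto simp: P)
    show "(u, v) \<in> parcs ?P \<longleftrightarrow> ?l ! u \<rightarrow> ?l ! v" if "u \<in> pverts ?P" "v \<in> pverts ?P" for u v
      using that unfolding P undirected_def insert_iff empty_iff
      by (elim disjE FalseE) (simp_all add: irrefl e e' n n')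
  qed
  moreover have "induced_subgraph (G \<restriction> (!) ?l ` pverts ?P) G"
    using e by (intro induced_induce) (auto simp: P dest: adj_in_verts)
  ultimately show False using free unfolding P6_dart_K4_free_def by blast
qed

text \<open>
  Here \<open>c\<close> and \<open>c'\<close> are the vertices of degree 3 of the diamond, \<open>d\<close> and \<open>d'\<close> those of degree 2,
  and \<open>p\<close> is the pendant vertex at \<open>c\<close>.
\<close>
lemma no_induced_dart:
  assumes e: "c \<rightarrow> c'" "c \<rightarrow> d" "c \<rightarrow> d'" "c' \<rightarrow> d" "c' \<rightarrow> d'" "c \<rightarrow> p"
    and n: "\<not> d \<rightarrow> d'" "\<not> p \<rightarrow> c'" "\<not> p \<rightarrow> d" "\<not> p \<rightarrow> d'"
    and "d \<noteq> d'"
  shows False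
proof -
  let ?l = "[c, d, c', d', p]"
  let ?P = "dart_graph"
  have e': "c' \<rightarrow> c" "d \<rightarrow> c" "d' \<rightarrow> c" "d \<rightarrow> c'" "d' \<rightarrow> c'" "p \<rightarrow> c" using e adj_sym by blast+
  have n': "\<not> d' \<rightarrow> d" "\<not> c' \<rightarrow> p" "\<not> d \<rightarrow> p" "\<not> d' \<rightarrow> p" using n adj_sym by blast+
  have dist: "distinct ?l"
    using e n e' n' adj_neq \<open>d \<noteq> d'\<close> by auto
  have P: "pverts ?P = {0, 1, 2, 3, 4}"
    "parcs ?P = undirected {(0, 1), (1, 2), (2, 3), (3, 0), (0, 2)} \<union> undirected {(0, 4)}"
    by (simp_all add: dart_graph_def diamond_edges_def)
  have "digraph_iso (with_proj ?P) (G \<restriction> (!) ?l ` pverts ?P)"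
  proof (rule digraph_iso_induce_image)
    show "wf_digraph (with_proj ?P)"
      by unfold_locales (auto simp: P undirected_def)
    show "inj_on ((!) ?l) (pverts ?P)"
      using dist by (intro inj_on_nth) (auto simp: P)
    show "(u, v) \<in> parcs ?P \<longleftrightarrow> ?l ! u \<rightarrow> ?l ! v" if "u \<in> pverts ?P" "v \<in> pverts ?P" for u v
      using that unfolding P undirected_def insert_iff empty_iff
      by (elim disjE FalseE) (simp_all add: irrefl e e' n n')
  qed
  moreover have "induced_subgraph (G \<restriction> (!) ?l ` pverts ?P) G"
    using e by (intro induced_induce) (auto simp: P dest: adj_in_verts)
  ultimately show False using free unfolding P6_dart_K4_free_def by blast
qed

lemma no_K4:
  assumes e: "a \<rightarrow> b" "a \<rightarrow> c" "a \<rightarrow> d" "b \<rightarrow> c" "b \<rightarrow> d" "c \<rightarrow> d"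
  shows False
proof -
  let ?F = "G \<restriction> {a, b, c, d}"
  have e': "b \<rightarrow> a" "c \<rightarrow> a" "d \<rightarrow> a" "c \<rightarrow> b" "d \<rightarrow> b" "d \<rightarrow> c" using e adj_sym by blast+
  have sub: "induced_subgraph ?F G"
    using e by (intro induced_induce) (auto dest: adj_in_verts)
  then have "graph ?F"
    using digraph.graphI[OF digraphI_induced induced_graph_imp_symmetric[OF sym_arcs]] by blast
  moreover have "card (verts ?F) = 4" using e adj_neq by (auto simp: card_insert_if)
  moreover have "arcs_ends ?F = {(u, v). (u, v) \<in> verts ?F \<times> verts ?F \<and> u \<noteq> v}"
  proof -
    have K: "u \<rightarrow> v \<longleftrightarrow> u \<noteq> v" if "u \<in> {a, b, c, d}" "v \<in> {a, b, c, d}" for u v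
      using that unfolding insert_iff empty_iff
      by (elim disjE FalseE) (simp_all add: irrefl e e' e[THEN adj_neq] e'[THEN adj_neq])
    have "(u, v) \<in> arcs_ends ?F \<longleftrightarrow> u \<in> verts ?F \<and> v \<in> verts ?F \<and> u \<noteq> v" for u v
      unfolding adj_induce_subgraph_iff induce_subgraph_verts using K by metis
    then show ?thesis by (simp only: set_eq_iff split_paired_All mem_Collect_eq prod.case mem_Sigma_iff
        conj_assoc simp_thms)
  qed
  ultimately have "K\<^bsub>4\<^esub> ?F" by (simp add: complete_digraph_def)
  with sub free show False unfolding P6_dart_K4_free_def by blast
qed

end

section \<open>Attachments to an induced diamond\<close>

text \<open>
  An induced diamond \<open>H\<close> in a \<open>{P\<^sub>6, dart, K\<^sub>4}\<close>-free graph \<open>G\<close>; the vertices \<open>u\<^sub>1\<close> and \<open>u\<^sub>3\<close> are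
  those of degree 3 in \<open>H\<close>.
\<close>
locale diamond_in_free_graph = P6_dart_K4_free_graph G for G :: "('a, 'b) pre_digraph" (structure) +
  fixes H :: "('a, 'b) pre_digraph" and u1 u2 u3 u4 :: 'a
  assumes induced: "induced_subgraph H G"
    and dist: "distinct [u1, u2, u3, u4]"
    and verts_H: "verts H = {u1, u2, u3, u4}"
    and ends_H: "arcs_ends H = diamond_edges u1 u2 u3 u4"
begin

abbreviation "A2 \<equiv> attached G H {u2}"
abbreviation "B13 \<equiv> attached G H {u1, u3}"
abbreviation "Z \<equiv> attached G H {}"

lemma adj_H:
  "u1 \<rightarrow> u2" "u1 \<rightarrow> u4" "u4 \<rightarrow> u1" "\<not> u4 \<rightarrow> u2"
proof -
  have H: "u \<rightarrow> v \<longleftrightarrow> (u, v) \<in> diamond_edges u1 u2 u3 u4"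
    if "u \<in> {u1, u2, u3, u4}" "v \<in> {u1, u2, u3, u4}" for u v
  proof -
    have "H = G \<restriction> {u1, u2, u3, u4}"
      using induce_eq_iff_induced[OF induced] by (simp add: verts_H)
    then have "u \<rightarrow>\<^bsub>H\<^esub> v \<longleftrightarrow> u \<rightarrow> v" using that adj_induce_subgraph_iff by metis
    then show ?thesis by (simp add: ends_H)
  qed
  show "u1 \<rightarrow> u2" "u1 \<rightarrow> u4" "u4 \<rightarrow> u1" "\<not> u4 \<rightarrow> u2"
    using dist by (auto simp: H diamond_edges_def undirected_def)
qed

lemma attached_adj_iff:
  assumes "x \<in> attached G H T" "v \<in> {u1, u2, u3, u4}"
  shows "x \<rightarrow> v \<longleftrightarrow> v \<in> T" "v \<rightarrow> x \<longleftrightarrow> v \<in> T"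
  using assms adj_sym unfolding attached_def nbrs_in_def verts_H by blast+

lemma A2D:
  assumes "a \<in> A2"
  shows "a \<rightarrow> u2" "u2 \<rightarrow> a" "\<not> a \<rightarrow> u1" "\<not> u1 \<rightarrow> a" "\<not> a \<rightarrow> u4" "\<not> u4 \<rightarrow> a"
  using attached_adj_iff[OF assms] dist by auto

lemma B13D:
  assumes "b \<in> B13"
  shows "b \<rightarrow> u1" "u1 \<rightarrow> b" "\<not> b \<rightarrow> u2" "\<not> u2 \<rightarrow> b" "\<not> b \<rightarrow> u4" "\<not> u4 \<rightarrow> b"
  using attached_adj_iff[OF assms] dist by auto

lemma ZD:
  assumes "q \<in> Z"
  shows "\<not> q \<rightarrow> u1" "\<not> u1 \<rightarrow> q" "\<not> q \<rightarrow> u2" "\<not> u2 \<rightarrow> q" "\<not> q \<rightarrow> u4" "\<not> u4 \<rightarrow> q"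
  using attached_adj_iff[OF assms] by auto

lemma A2_complete_to_Z_edge:
  assumes "a \<in> A2" "q \<in> Z" "q' \<in> Z" "q \<rightarrow> q'" "a \<rightarrow> q"
  shows "a \<rightarrow> q'"
  using no_induced_P6[of u4 u1 u2 a q q'] adj_H assms A2D[of a] ZD[of q] ZD[of q'] by blast

lemma A2_nbrs_of_Z_edge_stable:
  assumes "a \<in> A2" "a' \<in> A2" "q \<in> Z" "q' \<in> Z" "q \<rightarrow> q'" "a \<rightarrow> q" "a' \<rightarrow> q"
  shows "\<not> a \<rightarrow> a'"
  using no_K4[of a a' q q'] A2_complete_to_Z_edge[of _ q q'] assms by blast

text \<open>
  The vertex \<open>b\<close> is also adjacent to \<open>q'\<close>: otherwise it is adjacent to neither of \<open>x\<^sub>1, x\<^sub>2\<close>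
  (a dart with pendant edge \<open>x\<^sub>i u\<^sub>2\<close>), and is itself the pendant vertex of a dart on
  \<open>q, q', x\<^sub>1, x\<^sub>2\<close>. Hence an edge \<open>b x\<^sub>1\<close> completes a \<open>K\<^sub>4\<close> on \<open>b, x\<^sub>1, q, q'\<close>.
\<close>
lemma B13_nbr_of_Z_edge_anticomplete:
  assumes x: "x1 \<in> A2" "x2 \<in> A2" "x1 \<noteq> x2" "x1 \<rightarrow> q" "x2 \<rightarrow> q"
    and q: "q \<in> Z" "q' \<in> Z" "q \<rightarrow> q'"
    and b: "b \<in> B13" "b \<rightarrow> q"
  shows "\<not> b \<rightarrow> x1"
proof
  assume bx: "b \<rightarrow> x1"
  have xq': "x1 \<rightarrow> q'" "x2 \<rightarrow> q'" using A2_complete_to_Z_edge[OF _ q] x by blast+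
  have "b \<rightarrow> q'"
  proof (rule ccontr)
    assume nb: "\<not> b \<rightarrow> q'"
    have "b \<noteq> q'" using B13D(1)[OF b(1)] ZD(1)[OF q(2)] by blast
    have nx: "\<not> b \<rightarrow> x" if "x \<in> A2" "x \<rightarrow> q" "x \<rightarrow> q'" for x
      using no_induced_dart[of x q q' b u2] that nb \<open>b \<noteq> q'\<close> b q ZD[of q] ZD[of q']
        B13D[of b] A2D[of x] adj_sym[of b] adj_sym[of q' b] by blast
    have "\<not> x1 \<rightarrow> x2" using A2_nbrs_of_Z_edge_stable[OF _ _ q] x by blast
    then show False
      using no_induced_dart[of q q' x1 x2 b] nx x xq' q b nb adj_sym[of _ q] adj_sym[of _ q'] by blast
  qed
  then show False using no_K4[of b x1 q q'] bx x xq' q b by blast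
qed

lemma B13_adj_invariant_step:
  assumes x: "x1 \<in> A2" "x2 \<in> A2" "x1 \<noteq> x2" "x1 \<rightarrow> q" "x2 \<rightarrow> q"
    and q: "q \<in> Z" "q' \<in> Z" "q \<rightarrow> q'"
    and b: "b \<in> B13" "b \<rightarrow> x1"
  shows "b \<rightarrow> x2"
proof (rule ccontr)
  assume nb: "\<not> b \<rightarrow> x2"
  have "\<not> b \<rightarrow> q" using B13_nbr_of_Z_edge_anticomplete[OF x q b(1)] b(2) by blast
  moreover have "\<not> x2 \<rightarrow> x1" using A2_nbrs_of_Z_edge_stable[OF _ _ q] x by blast
  ultimately show False
    using no_induced_P6[of x2 q x1 b u1 u4] nb x b ZD[of q] B13D[of b] A2D[of x1] A2D[of x2]
      adj_H q(1) adj_sym[of x1 q] adj_sym[of b x1] adj_sym[of x2 b] adj_sym[of q b] by blast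
qed

section \<open>Components of the auxiliary graph\<close>

text \<open>
  Of the badness of a component, an edge of \<open>S\<close> retains an edge \<open>qq'\<close> of \<open>G[Z]\<close> whose end \<open>q\<close>
  has a neighbour in \<open>B\<^sub>1\<^sub>3\<close> and is adjacent to both ends of the edge of \<open>S\<close>.
\<close>
lemma aux_graph_adjE:
  assumes "x1 \<rightarrow>\<^bsub>with_proj (aux_graph G H u1 u2 u3)\<^esub> x2"
  obtains q q' b where "x1 \<in> A2" "x2 \<in> A2" "x1 \<noteq> x2" "x1 \<rightarrow> q" "x2 \<rightarrow> q"
    "q \<in> Z" "q' \<in> Z" "q \<rightarrow> q'" "b \<in> B13" "b \<rightarrow> q"
proof -
  from assms obtain Q where x: "x1 \<in> A2" "x2 \<in> A2" "x1 \<noteq> x2" and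
    Q: "bad_component G H u1 u2 u3 Q" and xQ: "x1 \<in> A2_nbrs G H u2 Q" "x2 \<in> A2_nbrs G H u2 Q"
    by (auto simp: aux_graph_def)
  from Q obtain q q' b where q: "Q = {q, q'}" "q \<rightarrow> q'" and b: "b \<in> B13" "q \<rightarrow> b"
    unfolding bad_component_def by blast
  have subset: "Q' \<subseteq> X" if "Q' \<in> components (G \<restriction> X)" for X Q'
    using wf_digraph.sccs_verts_subsets[OF wellformed_induce_subgraph that] by simp
  have "Z1 G H u2 \<subseteq> Z" unfolding Z1_def using subset by blast
  moreover have "Q \<subseteq> Z1 G H u2" using Q subset unfolding bad_component_def by blast
  ultimately have qZ: "q \<in> Z" "q' \<in> Z" using q by blast+
  have "x \<rightarrow> q" if "x \<in> A2_nbrs G H u2 Q" for x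
    using that A2_complete_to_Z_edge[of x q' q] qZ q adj_sym unfolding A2_nbrs_def by blast
  then show thesis using that x xQ qZ q b adj_sym by blast
qed

lemma wf_aux_graph: "wf_digraph (with_proj (aux_graph G H u1 u2 u3))"
  by unfold_locales (auto simp: aux_graph_def)

lemma adjacent_not_reachable_in_aux_graph:
  assumes "x \<in> A2" "y \<in> A2" "x \<rightarrow> y"
  shows "\<not> x \<rightarrow>\<^sup>*\<^bsub>with_proj (aux_graph G H u1 u2 u3)\<^esub> y"
proof
  let ?S = "with_proj (aux_graph G H u1 u2 u3)"
  interpret S: wf_digraph ?S by (rule wf_aux_graph)
  assume reach: "x \<rightarrow>\<^sup>*\<^bsub>?S\<^esub> y"
  obtain x1 where "x \<rightarrow>\<^bsub>?S\<^esub> x1"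
    using pre_digraph.converse_reachable_cases[OF reach] adj_neq[OF \<open>x \<rightarrow> y\<close>] by metis
  then obtain q q' b where x1: "x1 \<in> A2" "x \<noteq> x1" "x \<rightarrow> q" "x1 \<rightarrow> q"
    and q: "q \<in> Z" "q' \<in> Z" "q \<rightarrow> q'" and b: "b \<in> B13" "b \<rightarrow> q"
    by (rule aux_graph_adjE)
  have "\<not> b \<rightarrow> x" using B13_nbr_of_Z_edge_anticomplete[of x x1 q q' b] assms x1 q b by blast
  moreover have "b \<rightarrow> y \<longrightarrow> b \<rightarrow> x"
    using reach
  proof (induction rule: S.converse_reachable_induct)
    case (step v w)
    show ?case
    proof
      assume "b \<rightarrow> y"
      then have "b \<rightarrow> w" using step.IH by simp
      with step.hyps(1) show "b \<rightarrow> v"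
        using B13_adj_invariant_step[of w v _ _ b] b(1) by (elim aux_graph_adjE) blast
    qed
  qed simp
  moreover have "\<not> y \<rightarrow> q" using A2_nbrs_of_Z_edge_stable[OF assms(1,2) q] x1 assms(3) by blast
  ultimately show False
    using no_induced_P6[of y x q b u1 u4] assms x1(3) b ZD[OF q(1)] B13D[of b] A2D[of x] A2D[of y]
      adj_H adj_sym[of x y] adj_sym[of b q] adj_sym[of y b] adj_sym[of x b] by blast
qed

end

theorem lemma2p6:
  fixes G H :: "('a,'b) pre_digraph" and u1 u2 u3 u4 x y :: 'a
  assumes "graph G" and "connected G"
    and "P6_dart_K4_free G"
    and "\<not> (\<exists>K. clique_cutset G K)"
    and "induced_subgraph H G"
    and "distinct [u1, u2, u3, u4]"
    and "verts H = {u1, u2, u3, u4}"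
    and "arcs_ends H = diamond_edges u1 u2 u3 u4"
    and "attached G H {u2, u3, u4} = {}"
    and "attached G H {u4, u1, u2} = {}"
    and "attached G H {u1, u3} \<noteq> {}"
    and "x \<in> attached G H {u2}" and "y \<in> attached G H {u2}"
    and "x \<rightarrow>\<^bsub>G\<^esub> y"
  shows "\<exists>X \<in> components (with_proj (aux_graph G H u1 u2 u3)).
         \<exists>Y \<in> components (with_proj (aux_graph G H u1 u2 u3)).
           x \<in> X \<and> y \<in> Y \<and> X \<noteq> Y"
proof -
  interpret graph G by fact
  interpret diamond_in_free_graph G H u1 u2 u3 u4
    using assms by unfold_locales auto
  let ?S = "with_proj (aux_graph G H u1 u2 u3)"
  interpret S: wf_digraph ?S by (rule wf_aux_graph)
  have xy: "x \<in> verts ?S" "y \<in> verts ?S" using assms by (simp_all add: aux_graph_def)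
  have "y \<notin> S.scc_of x"
    using adjacent_not_reachable_in_aux_graph assms by (simp add: S.scc_of_def)
  then show ?thesis
    using S.scc_of_in_sccs_verts[of x] S.scc_of_in_sccs_verts[of y]
      S.in_scc_of_self[of x] S.in_scc_of_self[of y] xy by blast
qed

end
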